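(* Let $m$ be a positive integer and let $G$ be a finite simple $2$-connected graph with minimum degree $\delta(G)\geq m+2$. Then for every star $T$ of order $m$, $G$ contains a subgraph $T'$ isomorphic to $T$ such that $G-V(T')$ is $2$-connected.
   Context: Graphs are finite, undirected, without loops or multiple edges. A tree is a connected graph without cycles. A star is a tree having exactly one vertex of degree greater than one. The order of a graph is its number of vertices. $G-V(T')$ denotes the subgraph of $G$ induced by $V(G)\setminus V(T')$. *)

theory Defs
  imports "Graph_Theory.Digraph_Isomorphism"
begin

text \<open>
  Finite simple graphs are rendered by the locale \<^locale>\<open>graph\<close> of \<^theory>\<open>Graph_Theory.Digraph\<close>:
  finite, loop-free, symmetric digraphs without parallel arcs. An edge \<open>uv\<close> is the pair of
  opposite arcs \<open>(u,v)\<close>, \<open>(v,u)\<close>, so the degree of \<open>v\<close> is \<^term>\<open>out_degree G v\<close>.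
\<close>

text \<open>
  In a symmetric digraph the library's \<^const>\<open>pre_digraph.cycle\<close> also holds of the closed walk
  \<open>u,v,u\<close>, which is not a cycle of the undirected graph. Hence the library's \<^const>\<open>forest\<close> and
  \<^const>\<open>tree\<close> fail for every symmetric digraph with an edge, and the undirected notions require
  cycles to have length at least 3.
\<close>

definition ucycle :: "('a,'b) pre_digraph \<Rightarrow> 'b list \<Rightarrow> bool" where
  "ucycle G p \<longleftrightarrow> pre_digraph.cycle G p \<and> length p \<ge> 3"

definition utree :: "('a,'b) pre_digraph \<Rightarrow> bool" where
  "utree G \<longleftrightarrow> graph G \<and> connected G \<and> \<not> (\<exists>p. ucycle G p)"

text \<open>By this definition a star has at least three vertices; \<open>K\<^sub>1\<close> and \<open>K\<^sub>2\<close> are not stars.\<close>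

definition star :: "('a,'b) pre_digraph \<Rightarrow> bool" where
  "star G \<longleftrightarrow> utree G \<and> (\<exists>!v. v \<in> verts G \<and> out_degree G v > 1)"

text \<open>Meaningful only for finite nonempty \<open>verts G\<close>.\<close>

definition min_degree :: "('a,'b) pre_digraph \<Rightarrow> nat" where
  "min_degree G = Min (out_degree G ` verts G)"

definition delete_verts :: "('a,'b) pre_digraph \<Rightarrow> 'a set \<Rightarrow> ('a,'b) pre_digraph" where
  "delete_verts G X = G \<restriction> (verts G - X)"

definition k_connected :: "nat \<Rightarrow> ('a,'b) pre_digraph \<Rightarrow> bool" where
  "k_connected k G \<longleftrightarrow> card (verts G) > k \<and>
     (\<forall>X. X \<subseteq> verts G \<and> card X < k \<longrightarrow> connected (delete_verts G X))"

end

theory Submission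
  imports Defs
begin

text \<open>
  Call a vertex set \<open>S\<close> nonseparable if \<open>|S| \<ge> 2\<close> and \<open>S - {v}\<close> induces a connected graph for every
  \<open>v\<close>; an edge is nonseparable, and adding an ear (a path outside \<open>S\<close> joining two distinct vertices
  of \<open>S\<close>) keeps \<open>S\<close> nonseparable. Choose \<open>S\<close> of maximum size among the nonseparable sets whose
  complement contains a star of order \<open>m\<close>. If the complement \<open>H\<close> of \<open>S\<close> were larger than that star,
  take a shortest ear \<open>P\<close> in \<open>H\<close>. Shortcuts show that a vertex of \<open>H\<close> with at most one neighbour in
  \<open>S\<close> has at most three neighbours in \<open>S \<union> P\<close>, so by the degree condition it has at least \<open>m - 1\<close>
  neighbours outside. This yields a star avoiding \<open>S \<union> P\<close>, contradicting the maximality of \<open>S\<close>.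
\<close>

section \<open>Walks as lists, and connectivity through closed vertex sets\<close>

lemma successively_take: "successively P p \<Longrightarrow> successively P (take n p)"
  by (metis append_take_drop_id successively_append_iff)

lemma successively_drop: "successively P p \<Longrightarrow> successively P (drop n p)"
  by (metis append_take_drop_id successively_append_iff)

text \<open>A closed set contains everything reachable from its members; conversely, the vertices
  reachable from \<open>u\<close> form a closed set. Connectivity can then be proved by inspecting
  sets instead of constructing walks.\<close>

lemma (in sym_digraph) connected_iff_cut:
  "connected G \<longleftrightarrow> verts G \<noteq> {} \<and>
     (\<forall>X \<subseteq> verts G. X \<noteq> {} \<longrightarrow> (\<forall>u\<in>X. \<forall>v. u \<rightarrow>\<^bsub>G\<^esub> v \<longrightarrow> v \<in> X) \<longrightarrow> X = verts G)"
  (is "?L \<longleftrightarrow> ?R")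
proof
  have reach: "connected G \<longleftrightarrow> verts G \<noteq> {} \<and> (\<forall>u\<in>verts G. \<forall>v\<in>verts G. u \<rightarrow>\<^sup>*\<^bsub>G\<^esub> v)"
    unfolding connected_def strongly_connected_def
    by (simp add: reachable_mk_symmetric_eq[OF sym_arcs])
  show ?R if ?L
  proof (intro conjI allI impI)
    show "verts G \<noteq> {}" using that reach by simp
    fix X assume X: "X \<subseteq> verts G" "X \<noteq> {}" "\<forall>u\<in>X. \<forall>v. u \<rightarrow>\<^bsub>G\<^esub> v \<longrightarrow> v \<in> X"
    then obtain u where u: "u \<in> X" by auto
    have "v \<in> X" if "v \<in> verts G" for v
    proof -
      have "u \<rightarrow>\<^sup>*\<^bsub>G\<^esub> v" using \<open>?L\<close> reach that u X(1) by auto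
      then show ?thesis by (induct rule: reachable_induct) (use u X in auto)
    qed
    then show "X = verts G" using X by auto
  qed
  show ?L if R: ?R
    unfolding reach
  proof (intro conjI ballI)
    show "verts G \<noteq> {}" using R by simp
    fix u v assume uv: "u \<in> verts G" "v \<in> verts G"
    have "{w. u \<rightarrow>\<^sup>*\<^bsub>G\<^esub> w} = verts G"
    proof (rule R[THEN conjunct2, rule_format])
      show "{w. u \<rightarrow>\<^sup>*\<^bsub>G\<^esub> w} \<subseteq> verts G" using reachable_in_verts by auto
      show "{w. u \<rightarrow>\<^sup>*\<^bsub>G\<^esub> w} \<noteq> {}" using uv by auto
    qed (auto intro: reachable_adj_trans)
    then show "u \<rightarrow>\<^sup>*\<^bsub>G\<^esub> v" using uv by auto
  qed
qed

section \<open>Nonseparable sets, ears and neighbourhoods\<close>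

context graph
begin

text \<open>Any \<open>v\<close> outside \<open>S\<close> yields connectivity of \<open>S\<close>
  itself. The bound 2, where \<open>k_connected 2\<close> demands three vertices, admits a single
  edge as a starting point.\<close>

definition nonseparable :: "'a set \<Rightarrow> bool" where
  "nonseparable S \<longleftrightarrow> S \<subseteq> verts G \<and> 2 \<le> card S \<and> (\<forall>v. connected (G \<restriction> (S - {v})))"

text \<open>The list holds only the inner vertices, and repetitions are allowed, so shortcuts of
  walks are ears without further checks. A single vertex with two neighbours in \<open>S\<close> is
  an ear.\<close>

definition ear :: "'a set \<Rightarrow> 'a list \<Rightarrow> bool" where
  "ear S p \<longleftrightarrow> p \<noteq> [] \<and> set p \<subseteq> verts G - S \<and> successively (dominates G) p \<and>
     (\<exists>s\<in>S. \<exists>t\<in>S. s \<noteq> t \<and> s \<rightarrow>\<^bsub>G\<^esub> hd p \<and> last p \<rightarrow>\<^bsub>G\<^esub> t)"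

definition nbrs :: "'a \<Rightarrow> 'a set" where
  "nbrs v = {w. v \<rightarrow>\<^bsub>G\<^esub> w}"

lemma mem_nbrs [simp]: "w \<in> nbrs v \<longleftrightarrow> v \<rightarrow>\<^bsub>G\<^esub> w"
  by (simp add: nbrs_def)

lemma nbrs_subset: "nbrs v \<subseteq> verts G"
  using adj_in_verts by auto

lemma finite_nbrs [simp]: "finite (nbrs v)"
  using finite_subset[OF nbrs_subset] by simp

lemma not_mem_nbrs_self: "v \<notin> nbrs v"
  using adj_not_same by auto

text \<open>Without parallel arcs, an arc leaving \<open>v\<close> is determined by its
  head.\<close>

lemma card_nbrs: "card (nbrs v) = out_degree G v"
proof -
  have "bij_betw (head G) (out_arcs G v) (nbrs v)"
    unfolding bij_betw_def
  proof
    show "inj_on (head G) (out_arcs G v)"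
      by (auto simp: inj_on_def arc_to_ends_def intro!: no_multi_arcs)
    show "head G ` out_arcs G v = nbrs v"
      by (auto simp: arcs_ends_conv)
  qed
  then show ?thesis
    unfolding out_degree_def by (simp add: bij_betw_same_card)
qed

section \<open>Connectivity of induced subgraphs\<close>

lemma dominates_sym: "u \<rightarrow>\<^bsub>G\<^esub> v \<longleftrightarrow> v \<rightarrow>\<^bsub>G\<^esub> u"
  using graph_symmetric by blast

lemma dominates_induce_iff: "u \<rightarrow>\<^bsub>G \<restriction> A\<^esub> v \<longleftrightarrow> u \<in> A \<and> v \<in> A \<and> u \<rightarrow>\<^bsub>G\<^esub> v"
  by (auto simp: arcs_ends_conv induce_subgraph_def image_iff)

lemma sym_digraph_induce: "A \<subseteq> verts G \<Longrightarrow> sym_digraph (G \<restriction> A)"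
  by (rule induced_graph_imp_graph) auto

lemma connected_induce_iff:
  assumes "A \<subseteq> verts G"
  shows "connected (G \<restriction> A) \<longleftrightarrow> A \<noteq> {} \<and>
     (\<forall>X \<subseteq> A. X \<noteq> {} \<longrightarrow> (\<forall>u\<in>X. \<forall>v\<in>A. u \<rightarrow>\<^bsub>G\<^esub> v \<longrightarrow> v \<in> X) \<longrightarrow> X = A)"
proof -
  have "(\<forall>u\<in>X. \<forall>v. u \<rightarrow>\<^bsub>G \<restriction> A\<^esub> v \<longrightarrow> v \<in> X) \<longleftrightarrow> (\<forall>u\<in>X. \<forall>v\<in>A. u \<rightarrow>\<^bsub>G\<^esub> v \<longrightarrow> v \<in> X)"
    if "X \<subseteq> A" for X
    using that by (auto simp: dominates_induce_iff)
  then show ?thesis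
    unfolding sym_digraph.connected_iff_cut[OF sym_digraph_induce[OF assms]] by simp
qed


lemma connected_induce_insert:
  assumes "connected (G \<restriction> A)" "A \<subseteq> verts G" "a \<in> A" "a \<rightarrow>\<^bsub>G\<^esub> x"
  shows "connected (G \<restriction> insert x A)"
proof -
  have A: "insert x A \<subseteq> verts G" using assms adj_in_verts by auto
  show ?thesis
    unfolding connected_induce_iff[OF A]
  proof (intro conjI allI impI)
    fix X
    assume X: "X \<subseteq> insert x A" "X \<noteq> {}" "\<forall>u\<in>X. \<forall>v\<in>insert x A. u \<rightarrow>\<^bsub>G\<^esub> v \<longrightarrow> v \<in> X"
    have "x \<rightarrow>\<^bsub>G\<^esub> a" using assms(4) dominates_sym by blast
    \<comment> \<open>If \<open>X\<close> contains \<open>x\<close>, it also contains the neighbour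
      \<open>a\<close> of \<open>x\<close>; otherwise it lies within \<open>A\<close>.\<close>
    then have "X \<inter> A \<noteq> {}" using X assms(3) by blast
    then have "X \<inter> A = A"
      using assms(1)[unfolded connected_induce_iff[OF assms(2)]] X by blast
    then show "X = insert x A" using X assms(3,4) by blast
  qed simp
qed

text \<open>The vertices of the walk are attached one at a time, each through its predecessor. The
  walk may return to \<open>A\<close>.\<close>

lemma connected_induce_walk:
  assumes "connected (G \<restriction> A)" "A \<subseteq> verts G" "a \<in> A" "successively (dominates G) (a # q)"
  shows "connected (G \<restriction> (A \<union> set q))"
  using assms
proof (induction q arbitrary: a A)
  case (Cons x q)
  have "connected (G \<restriction> (insert x A \<union> set q))"
    by (rule Cons.IH[of _ x]) (use Cons.prems adj_in_verts connected_induce_insert in auto)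
  then show ?case by simp
qed simp

section \<open>Ears and their addition to nonseparable sets\<close>

lemma successively_dominates_rev:
  "successively (dominates G) (rev p) \<longleftrightarrow> successively (dominates G) p"
  by (simp add: dominates_sym)

lemma earI:
  assumes "p \<noteq> []" "set p \<subseteq> verts G - S" "successively (dominates G) p"
    and "s \<in> S" "t \<in> S" "s \<noteq> t" "s \<rightarrow>\<^bsub>G\<^esub> hd p" "last p \<rightarrow>\<^bsub>G\<^esub> t"
  shows "ear S p"
  unfolding ear_def using assms by metis

text \<open>The two walks enter the ear from opposite ends, so both pieces left by deleting an inner
  vertex can be attached to \<open>S\<close>.\<close>

lemma earE:
  assumes "ear S p"
  obtains s t where "s \<in> S" "t \<in> S" "s \<noteq> t"
    "successively (dominates G) (s # p)" "successively (dominates G) (t # rev p)"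
    "p \<noteq> []" "set p \<subseteq> verts G - S"
proof -
  obtain s t where st: "s \<in> S" "t \<in> S" "s \<noteq> t" "s \<rightarrow>\<^bsub>G\<^esub> hd p" "last p \<rightarrow>\<^bsub>G\<^esub> t"
    and p: "p \<noteq> []" "set p \<subseteq> verts G - S" "successively (dominates G) p"
    using assms unfolding ear_def by auto
  have "successively (dominates G) (s # p)" "successively (dominates G) (t # rev p)"
    using st p by (auto simp: successively_Cons successively_dominates_rev hd_rev dominates_sym
        simp del: successively_rev)
  then show thesis using that st p by blast
qed

text \<open>If the deleted \<open>v\<close> lies on the ear, the part before it hangs on
  \<open>s\<close> and the part after it on \<open>t\<close>; distinctness keeps \<open>v\<close>
  out of both parts. If not, at least one of \<open>s\<close> and \<open>t\<close> survives and
  carries the whole ear.\<close>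

lemma nonseparable_Un_ear:
  assumes S: "nonseparable S" and p: "ear S p" "distinct p"
  shows "nonseparable (S \<union> set p)"
proof -
  have SV: "S \<subseteq> verts G" and conn: "\<And>v. connected (G \<restriction> (S - {v}))" and "2 \<le> card S"
    using S unfolding nonseparable_def by auto
  obtain s t where st: "s \<in> S" "t \<in> S" "s \<noteq> t"
    and sp: "successively (dominates G) (s # p)" and tp: "successively (dominates G) (t # rev p)"
    and pV: "set p \<subseteq> verts G - S"
    using p(1) by (rule earE)
  have "connected (G \<restriction> (S \<union> set p - {v}))" for v
  proof (cases "v \<in> set p")
    case True
    then obtain q r where pq: "p = q @ v # r" by (auto dest: split_list)
    have v: "v \<notin> S" "v \<notin> set q" "v \<notin> set r" using pV p(2) pq True by auto
    have "successively (dominates G) (s # q)"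
      using sp unfolding pq by (simp add: successively_append_iff flip: append_Cons)
    then have "connected (G \<restriction> (S \<union> set q))"
      by (intro connected_induce_walk[of _ s]) (use conn[of v] v SV st in auto)
    moreover have "successively (dominates G) (t # rev r)"
      using tp unfolding pq by (simp add: successively_append_iff flip: append_Cons)
    ultimately have "connected (G \<restriction> (S \<union> set q \<union> set (rev r)))"
      by (intro connected_induce_walk[of "S \<union> set q" t]) (use SV pV pq st in auto)
    moreover have "S \<union> set p - {v} = S \<union> set q \<union> set (rev r)" using pq v by auto
    ultimately show ?thesis by simp
  next
    case False
    have "connected (G \<restriction> ((S - {v}) \<union> set p))"
    proof (cases "v = s")
      case True
      have "connected (G \<restriction> ((S - {v}) \<union> set (rev p)))"
        by (rule connected_induce_walk[of _ t]) (use conn SV st tp True in auto)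
      then show ?thesis by simp
    next
      case False
      then show ?thesis
        by (intro connected_induce_walk[of _ s]) (use conn SV st sp in auto)
    qed
    moreover have "S \<union> set p - {v} = (S - {v}) \<union> set p" using False by auto
    ultimately show ?thesis by simp
  qed
  moreover have "card S \<le> card (S \<union> set p)"
    by (intro card_mono) (use SV finite_subset[OF _ finite_verts] in auto)
  ultimately show ?thesis
    using SV pV \<open>2 \<le> card S\<close> unfolding nonseparable_def by auto
qed

lemma nonseparable_edge:
  assumes "y \<rightarrow>\<^bsub>G\<^esub> z"
  shows "nonseparable {y, z}"
proof -
  have V: "{y, z} \<subseteq> verts G" and "y \<noteq> z" using assms adj_in_verts adj_not_same by auto
  have "connected (G \<restriction> ({y, z} - {v}))" for v
  proof -
    have sub: "{y, z} - {v} \<subseteq> verts G" using V by auto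
    show ?thesis
      unfolding connected_induce_iff[OF sub] using assms \<open>y \<noteq> z\<close> dominates_sym by blast
  qed
  then show ?thesis using V \<open>y \<noteq> z\<close> unfolding nonseparable_def by simp
qed

lemma reachable_induce_walk:
  assumes "u \<rightarrow>\<^sup>*\<^bsub>G \<restriction> A\<^esub> v"
  shows "\<exists>p. p \<noteq> [] \<and> hd p = u \<and> last p = v \<and> set p \<subseteq> A \<and> successively (dominates G) p"
proof -
  interpret A: wf_digraph "G \<restriction> A" by auto
  show ?thesis
    using assms
  proof (induct rule: A.converse_reachable_induct)
    case base
    then show ?case by (intro exI[of _ "[v]"]) auto
  next
    case (step x y)
    then obtain p where "p \<noteq> []" "hd p = y" "last p = v" "set p \<subseteq> A" "successively (dominates G) p"
      by auto
    then show ?case using step(1)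
      by (intro exI[of _ "x # p"]) (auto simp: successively_Cons dominates_induce_iff)
  qed
qed

text \<open>The component \<open>C\<close> of a vertex \<open>h\<close> outside \<open>S\<close> has
  two distinct neighbours in \<open>S\<close>; a walk within the complement of \<open>S\<close>
  between the corresponding vertices of \<open>C\<close> is an ear.\<close>

lemma ear_exists:
  assumes G: "nonseparable (verts G)" and S: "S \<subset> verts G" "2 \<le> card S"
  shows "\<exists>p. ear S p"
proof -
  obtain h where h: "h \<in> verts G - S" using S by auto
  define C where "C = {v. h \<rightarrow>\<^sup>*\<^bsub>G \<restriction> (verts G - S)\<^esub> v}"
  interpret H: sym_digraph "G \<restriction> (verts G - S)" by (rule sym_digraph_induce) auto
  have hC: "h \<in> C" unfolding C_def using h by auto
  have CV: "C \<subseteq> verts G - S" unfolding C_def using H.reachable_in_verts by auto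
  have closed: "v \<in> C" if "u \<in> C" "u \<rightarrow>\<^bsub>G\<^esub> v" "v \<notin> S" for u v
    using that CV adj_in_verts[of u v] unfolding C_def
    by (auto intro!: H.reachable_adj_trans[of h u v] simp: dominates_induce_iff)
  \<comment> \<open>If all edges from \<open>C\<close> to \<open>S\<close> ended in
    \<open>s\<close>, then \<open>C\<close> would be closed in the graph without \<open>s\<close>,
    hence all of it, leaving no room for a second vertex of \<open>S\<close>.\<close>
  have avoid: "\<exists>u\<in>C. \<exists>t\<in>S. t \<noteq> s \<and> u \<rightarrow>\<^bsub>G\<^esub> t" if "s \<in> S" for s
  proof (rule ccontr)
    assume *: "\<not> ?thesis"
    have sub: "verts G - {s} \<subseteq> verts G" by auto
    have conn: "connected (G \<restriction> (verts G - {s}))" using G unfolding nonseparable_def by auto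
    have "C = verts G - {s}"
      by (rule conn[unfolded connected_induce_iff[OF sub], THEN conjunct2, rule_format])
        (use CV hC that closed * in blast)+
    moreover have "\<not> S \<subseteq> {s}"
      using S(2) card_mono[of "{s}" S] by auto
    ultimately show False using CV S by blast
  qed
  obtain t\<^sub>0 where "t\<^sub>0 \<in> S" using S by fastforce
  then obtain u s where us: "u \<in> C" "s \<in> S" "u \<rightarrow>\<^bsub>G\<^esub> s" using avoid by blast
  \<comment> \<open>Avoiding the attachment \<open>s\<close> just found gives a second, different
    one.\<close>
  then obtain v t where vt: "v \<in> C" "t \<in> S" "t \<noteq> s" "v \<rightarrow>\<^bsub>G\<^esub> t" using avoid by blast
  have "u \<rightarrow>\<^sup>*\<^bsub>G \<restriction> (verts G - S)\<^esub> v"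
    using us vt H.symmetric_reachable' H.reachable_trans unfolding C_def by blast
  then obtain p where "p \<noteq> []" "hd p = u" "last p = v" "set p \<subseteq> verts G - S"
    "successively (dominates G) p"
    using reachable_induce_walk by blast
  moreover have "s \<rightarrow>\<^bsub>G\<^esub> u" using us dominates_sym by simp
  ultimately have "ear S p" using us vt by (intro earI[of p S s t]) auto
  then show ?thesis ..
qed

section \<open>Shortest ears and their chords\<close>

definition shortest_ear :: "'a set \<Rightarrow> 'a list \<Rightarrow> bool" where
  "shortest_ear S p \<longleftrightarrow> ear S p \<and> (\<forall>q. ear S q \<longrightarrow> length p \<le> length q)"

lemma shortest_ear_exists: "ear S p \<Longrightarrow> \<exists>q. shortest_ear S q"
  unfolding shortest_ear_def using ex_has_least_nat[of "ear S" p length] by blast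

text \<open>Used in contrapositive: a vertex that is not an ear by itself has at most one neighbour
  in \<open>S\<close>, as \<open>card_nbrs_shortest_ear\<close> requires.\<close>

lemma ear_singleton_iff:
  assumes "x \<in> verts G - S"
  shows "ear S [x] \<longleftrightarrow> 2 \<le> card (nbrs x \<inter> S)"
proof -
  have "ear S [x] \<longleftrightarrow> (\<exists>s\<in>S. \<exists>t\<in>S. s \<noteq> t \<and> x \<rightarrow>\<^bsub>G\<^esub> s \<and> x \<rightarrow>\<^bsub>G\<^esub> t)"
    using assms by (simp add: ear_def dominates_sym[of _ x])
  also have "\<dots> \<longleftrightarrow> \<not> card (nbrs x \<inter> S) \<le> Suc 0"
    by (subst card_le_Suc0_iff_eq) (simp, simp, metis IntD1 IntD2 IntI mem_nbrs)
  finally show ?thesis by auto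
qed

text \<open>Cutting out the closed piece between two occurrences of \<open>v\<close> leaves a
  shorter ear with the same ends.\<close>

lemma distinct_shortest_ear:
  assumes "shortest_ear S p"
  shows "distinct p"
proof (rule ccontr)
  assume "\<not> distinct p"
  then obtain q v r t where p: "p = q @ [v] @ r @ [v] @ t" by (auto dest: not_distinct_decomp)
  have "ear S (q @ [v] @ t)"
    using assms unfolding shortest_ear_def ear_def p
    by (auto simp: successively_append_iff successively_Cons hd_append split: if_splits)
  then show False using assms unfolding shortest_ear_def p by fastforce
qed

text \<open>Replacing everything strictly between positions \<open>i\<close> and \<open>j\<close> by
  \<open>x\<close> changes the length by \<open>i + 2 - j\<close>, which would be negative. The
  vertex \<open>x\<close> may itself lie on \<open>p\<close>, since ears may repeat
  vertices.\<close>

lemma shortest_ear_chord: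
  assumes p: "shortest_ear S p" and x: "x \<in> verts G - S"
    and ij: "i < length p" "j < length p" "x \<rightarrow>\<^bsub>G\<^esub> p ! i" "x \<rightarrow>\<^bsub>G\<^esub> p ! j"
  shows "j \<le> i + 2"
proof (rule ccontr)
  assume "\<not> j \<le> i + 2"
  let ?q = "take (Suc i) p @ x # drop j p"
  have q: "take (Suc i) p \<noteq> []" "hd (take (Suc i) p) = hd p" "last (take (Suc i) p) = p ! i"
    "drop j p \<noteq> []" "hd (drop j p) = p ! j" "last (drop j p) = last p"
    using ij by (auto simp: take_Suc_conv_app_nth hd_drop_conv_nth hd_append hd_conv_nth)
  have "set ?q \<subseteq> verts G - S"
    using p x set_take_subset[of "Suc i" p] set_drop_subset[of j p]
    unfolding shortest_ear_def ear_def by auto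
  moreover have "successively (dominates G) ?q"
    using p q ij unfolding shortest_ear_def ear_def
    by (auto simp: successively_append_iff successively_Cons successively_take successively_drop
        dominates_sym)
  ultimately have "ear S ?q"
    using p q unfolding shortest_ear_def ear_def by auto
  then have "length p \<le> length ?q" using p unfolding shortest_ear_def by auto
  then show False using ij \<open>\<not> j \<le> i + 2\<close> by simp
qed

text \<open>The neighbour \<open>s\<close> of \<open>x\<close> can serve as an end of a shortened
  ear. If \<open>s\<close> is the starting attachment \<open>a\<close>, enter at \<open>x\<close>
  and continue from position \<open>j\<close>; otherwise follow \<open>p\<close> up to position
  \<open>i\<close> and leave through \<open>x\<close> to \<open>s\<close>. The case distinction
  keeps the two attachments distinct.\<close>

lemma shortest_ear_chord_attached:
  assumes p: "shortest_ear S p" and x: "x \<in> verts G - S" "x \<rightarrow>\<^bsub>G\<^esub> s" "s \<in> S"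
    and ij: "i < length p" "j < length p" "x \<rightarrow>\<^bsub>G\<^esub> p ! i" "x \<rightarrow>\<^bsub>G\<^esub> p ! j"
  shows "j \<le> i + 1"
proof (rule ccontr)
  assume "\<not> j \<le> i + 1"
  obtain a b where ab: "a \<in> S" "b \<in> S" "a \<noteq> b" "a \<rightarrow>\<^bsub>G\<^esub> hd p" "last p \<rightarrow>\<^bsub>G\<^esub> b"
    and pp: "set p \<subseteq> verts G - S" "successively (dominates G) p"
    using p unfolding shortest_ear_def ear_def by blast
  have q: "take (Suc i) p \<noteq> []" "hd (take (Suc i) p) = hd p" "last (take (Suc i) p) = p ! i"
    "drop j p \<noteq> []" "hd (drop j p) = p ! j" "last (drop j p) = last p"
    using ij by (auto simp: take_Suc_conv_app_nth hd_drop_conv_nth hd_append hd_conv_nth)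
  have "\<exists>q. ear S q \<and> length q < length p"
  proof (cases "s = a")
    case True
    have "ear S (x # drop j p)"
      using ab x q pp ij True set_drop_subset[of j p] unfolding ear_def
      by (auto simp: successively_Cons successively_drop dominates_sym)
    then show ?thesis using ij \<open>\<not> j \<le> i + 1\<close> by (intro exI[of _ "x # drop j p"]) auto
  next
    case False
    have "set (take (Suc i) p @ [x]) \<subseteq> verts G - S"
      using x pp set_take_subset[of "Suc i" p] by auto
    moreover have "successively (dominates G) (take (Suc i) p @ [x])"
      using pp q ij by (simp add: successively_append_iff successively_take dominates_sym[of _ x])
    moreover have "a \<rightarrow>\<^bsub>G\<^esub> hd (take (Suc i) p @ [x])" "last (take (Suc i) p @ [x]) \<rightarrow>\<^bsub>G\<^esub> s"
      using ab x q by auto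
    ultimately have "ear S (take (Suc i) p @ [x])"
      using ab(1) x(3) False by (intro earI[of _ S a s]) auto
    moreover have "length (take (Suc i) p @ [x]) < length p"
      using ij(2) \<open>\<not> j \<le> i + 1\<close> by simp
    ultimately show ?thesis by blast
  qed
  then show False using p unfolding shortest_ear_def by (meson leD)
qed

text \<open>The positions of neighbours on \<open>p\<close> fit into a window of three indices
  starting at \<open>Min I\<close>, and into one of two if \<open>x\<close> also has a neighbour in
  \<open>S\<close>. As there is at most one such neighbour, the total stays within three.\<close>

lemma card_nbrs_shortest_ear:
  assumes p: "shortest_ear S p" and x: "x \<in> verts G - S" "card (nbrs x \<inter> S) \<le> 1"
  shows "card (nbrs x \<inter> (S \<union> set p)) \<le> 3"
proof -
  define I where "I = {i. i < length p \<and> x \<rightarrow>\<^bsub>G\<^esub> p ! i}"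
  have finI: "finite I" unfolding I_def by simp
  have "nbrs x \<inter> set p = (!) p ` I" unfolding I_def by (auto simp: in_set_conv_nth)
  then have pI: "card (nbrs x \<inter> set p) \<le> card I" using finI card_image_le by metis
  have I: "card I + card (nbrs x \<inter> S) \<le> 3"
  proof (cases "nbrs x \<inter> S = {} \<or> I = {}")
    case True
    have "I \<subseteq> {Min I..Min I + 2}" if "I \<noteq> {}"
      using shortest_ear_chord[OF p x(1)] Min_in[OF finI that] finI unfolding I_def by auto
    then have "card I \<le> 3"
      using card_mono[of "{Min I..Min I + 2}" I] by (cases "I = {}") auto
    then show ?thesis using True x(2) by auto
  next
    case False
    then obtain s where "x \<rightarrow>\<^bsub>G\<^esub> s" "s \<in> S" by auto
    then have "I \<subseteq> {Min I..Min I + 1}"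
      using shortest_ear_chord_attached[OF p x(1)] Min_in[OF finI] False finI
      unfolding I_def by auto
    then have "card I \<le> 2" using card_mono[of "{Min I..Min I + 1}" I] by auto
    then show ?thesis using x(2) by auto
  qed
  have "card (nbrs x \<inter> (S \<union> set p)) \<le> card (nbrs x \<inter> S) + card (nbrs x \<inter> set p)"
    unfolding Int_Un_distrib by (rule card_Un_le)
  then show ?thesis using pI I by linarith
qed

section \<open>The extremal argument\<close>

lemma star_with_nonseparable_complement:
  assumes G: "nonseparable (verts G)" and l: "1 \<le> l"
    and deg: "\<And>v. v \<in> verts G \<Longrightarrow> l + 3 \<le> card (nbrs v)"
  shows "\<exists>x L. x \<in> verts G \<and> L \<subseteq> nbrs x \<and> card L = l \<and> nonseparable (verts G - insert x L)"
proof -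
  define good where "good S \<longleftrightarrow> nonseparable S \<and>
    (\<exists>x L. x \<in> verts G - S \<and> L \<subseteq> nbrs x - S \<and> card L = l)" for S
  \<comment> \<open>With \<open>l = m - 1\<close> leaves, the degree bound \<open>m + 2\<close>
    reads \<open>l + 3\<close>: three neighbours of the centre may be lost to \<open>S\<close> and
    \<open>l\<close> leaves still remain.\<close>
  have goodI: "good S" if "nonseparable S" "x \<in> verts G - S" "card (nbrs x \<inter> S) \<le> 3" for S x
  proof -
    have "card (nbrs x) = card (nbrs x \<inter> S) + card (nbrs x - S)"
      by (rule card_Int_Diff) simp
    then have "l \<le> card (nbrs x - S)" using deg[of x] that by auto
    then show ?thesis
      unfolding good_def using that(1,2) by (meson obtain_subset_with_card_n)
  qed
  \<comment> \<open>Fix any star with \<open>l\<close> leaves at \<open>x\<close>. A further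
    neighbour \<open>y\<close> of \<open>x\<close> has degree above \<open>l + 1\<close>, the order
    of the star, so it has a neighbour \<open>z\<close> off the star, and the edge \<open>yz\<close>
    is the required set.\<close>
  have "\<exists>S. good S"
  proof -
    obtain x where x: "x \<in> verts G" using G unfolding nonseparable_def by fastforce
    obtain L where L: "L \<subseteq> nbrs x" "card L = l" "finite L"
      using deg[OF x] by (meson obtain_subset_with_card_n le_add1 le_trans)
    have "card (nbrs x - L) = card (nbrs x) - l" using L by (simp add: card_Diff_subset)
    then have "card (nbrs x - L) \<noteq> 0" using deg[OF x] by linarith
    then have "nbrs x - L \<noteq> {}" by (metis card.empty)
    then obtain y where y: "x \<rightarrow>\<^bsub>G\<^esub> y" "y \<notin> L" unfolding nbrs_def by blast
    then have "card (nbrs y) \<ge> l + 3" using deg adj_in_verts by blast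
    moreover have "card (insert x L) \<le> l + 1" using L by (simp add: card_insert_if)
    ultimately have "\<not> nbrs y \<subseteq> insert x L"
      using card_mono[of "insert x L" "nbrs y"] L(3) by auto
    then obtain z where z: "y \<rightarrow>\<^bsub>G\<^esub> z" "z \<noteq> x" "z \<notin> L"
      unfolding nbrs_def by blast
    have "good {y, z}"
      unfolding good_def using nonseparable_edge[OF z(1)] x y z L adj_not_same by blast
    then show ?thesis by blast
  qed
  moreover have "card S \<le> card (verts G)" if "good S" for S
    using that unfolding good_def nonseparable_def by (intro card_mono) auto
  ultimately obtain S where S: "good S" and max: "\<And>S'. good S' \<Longrightarrow> card S' \<le> card S"
    using ex_has_greatest_nat[of good _ card "Suc (card (verts G))"]
    by (metis less_Suc_eq_le)
  then obtain x L where x: "x \<in> verts G - S" and L: "L \<subseteq> nbrs x - S" "card L = l"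
    and nonsep: "nonseparable S"
    unfolding good_def by blast
  have SV: "S \<subset> verts G" "2 \<le> card S" using nonsep x unfolding nonseparable_def by auto
  have no_good: False if "good (S \<union> set p)" "ear S p" for p
  proof -
    have "p \<noteq> []" "set p \<inter> S = {}" using that unfolding ear_def by auto
    then obtain a where "a \<in> set p" "a \<notin> S" using last_in_set by blast
    then have "S \<subset> S \<union> set p" by blast
    moreover have "finite (S \<union> set p)" using SV finite_subset[of S "verts G"] by auto
    ultimately have "card S < card (S \<union> set p)" by (intro psubset_card_mono)
    then show False using max[OF that(1)] by simp
  qed
  have "S = verts G - insert x L"
  proof (rule ccontr)
    assume "S \<noteq> verts G - insert x L"
    then obtain h where h: "h \<in> verts G - S" "h \<noteq> x" "h \<notin> L" using x L SV by auto
    obtain p where p: "shortest_ear S p"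
      using ear_exists[OF G SV] shortest_ear_exists by blast
    have ear: "ear S p" using p unfolding shortest_ear_def by simp
    have nonsep_p: "nonseparable (S \<union> set p)"
      using nonseparable_Un_ear nonsep ear distinct_shortest_ear[OF p] by blast
    \<comment> \<open>Since \<open>h\<close> is off the star, adding \<open>h\<close> alone to
      \<open>S\<close> would leave the star intact and contradict maximality.\<close>
    have "\<not> ear S [h]"
    proof
      assume hear: "ear S [h]"
      then have "nonseparable (S \<union> set [h])" using nonseparable_Un_ear[OF nonsep hear] by simp
      then have "good (S \<union> set [h])" unfolding good_def using x L h by auto
      then show False using no_good hear by blast
    qed
    then have hS: "card (nbrs h \<inter> S) \<le> 1" using ear_singleton_iff[OF h(1)] by simp
    note h3 = card_nbrs_shortest_ear[OF p h(1) hS]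
    show False
    proof (cases "h \<in> set p")
      case False
      \<comment> \<open>Here \<open>h\<close> itself becomes the centre of a star avoiding
        \<open>S\<close> and \<open>p\<close>.\<close>
      then show False using goodI[OF nonsep_p _ h3] h no_good ear by blast
    next
      case True
      txt \<open>Now the shortest ears have length at least 2, so every vertex outside \<open>S\<close> has at most
        one neighbour in \<open>S\<close>, and the argument for \<open>h\<close> applies to a neighbour of \<open>h\<close> outside \<open>S \<union> set p\<close>.\<close>
      have "length p \<noteq> 1" using True ear \<open>\<not> ear S [h]\<close> by (auto simp: length_Suc_conv)
      moreover have "p \<noteq> []" using True by auto
      ultimately have "2 \<le> length p" by (cases p) (auto simp: Suc_le_eq)
      \<comment> \<open>As \<open>l\<close> is at least 1, \<open>h\<close> has at least four
        neighbours, of which at most three lie in this set.\<close>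
      have "\<not> nbrs h \<subseteq> S \<union> set p"
        using h3 deg[of h] l h by (auto simp: Int_absorb2)
      then obtain y where y: "h \<rightarrow>\<^bsub>G\<^esub> y" "y \<notin> S" "y \<notin> set p"
        unfolding nbrs_def by blast
      then have yV: "y \<in> verts G - S" using adj_in_verts by auto
      have "\<not> ear S [y]" using p \<open>2 \<le> length p\<close> unfolding shortest_ear_def by fastforce
      then have "card (nbrs y \<inter> S) \<le> 1" using ear_singleton_iff[OF yV] by simp
      from card_nbrs_shortest_ear[OF p yV this]
      show False using goodI[OF nonsep_p] yV y no_good ear by blast
    qed
  qed
  then show ?thesis using x L nonsep by blast
qed

section \<open>Stars as subgraphs and their isomorphism type\<close>

definition star_at :: "'a \<Rightarrow> 'a set \<Rightarrow> ('a, 'b) pre_digraph" where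
  "star_at x L = \<lparr>verts = insert x L,
     arcs = {e \<in> arcs G. tail G e = x \<and> head G e \<in> L \<or> head G e = x \<and> tail G e \<in> L},
     tail = tail G, head = head G\<rparr>"

lemma verts_star_at [simp]: "verts (star_at x L) = insert x L"
  by (simp add: star_at_def)

lemma subgraph_star_at:
  assumes "x \<in> verts G" "L \<subseteq> nbrs x"
  shows "subgraph (star_at x L) G"
proof (rule subgraphI)
  show "verts (star_at x L) \<subseteq> verts G" using assms nbrs_subset by auto
  show "wf_digraph (star_at x L)" by unfold_locales (auto simp: star_at_def)
qed (auto simp: star_at_def compatible_def wf_digraph)

text \<open>All edges from the centre to \<open>L\<close> are present because \<open>L\<close>
  consists of neighbours of \<open>x\<close>; edges of \<open>G\<close> between leaves were filtered
  out, so \<open>star_at x L\<close> need not be induced.\<close>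

lemma dominates_star_at:
  assumes "L \<subseteq> nbrs x"
  shows "u \<rightarrow>\<^bsub>star_at x L\<^esub> v \<longleftrightarrow> u = x \<and> v \<in> L \<or> v = x \<and> u \<in> L"
proof -
  have "u \<rightarrow>\<^bsub>star_at x L\<^esub> v \<longleftrightarrow> u \<rightarrow>\<^bsub>G\<^esub> v \<and> (u = x \<and> v \<in> L \<or> v = x \<and> u \<in> L)"
    by (auto simp: star_at_def arcs_ends_conv)
  then show ?thesis using assms dominates_sym[of u x] by auto
qed

end

text \<open>Every vertex other than the centre has degree at most one, so connectivity forces it to
  be adjacent to the centre. The centre has two neighbours, which gives three vertices.\<close>

lemma star_center:
  assumes "star T"
  shows "\<exists>c\<in>verts T. \<forall>u v. u \<rightarrow>\<^bsub>T\<^esub> v \<longleftrightarrow> u \<in> verts T \<and> v \<in> verts T \<and> u \<noteq> v \<and> (u = c \<or> v = c)"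
    and "3 \<le> card (verts T)"
proof -
  interpret T: graph T using assms unfolding star_def utree_def by simp
  obtain c where c: "c \<in> verts T" "1 < card (T.nbrs c)"
    and uniq: "\<And>v. v \<in> verts T \<Longrightarrow> v \<noteq> c \<Longrightarrow> card (T.nbrs v) \<le> Suc 0"
    using assms unfolding star_def T.card_nbrs by (metis One_nat_def not_le)
  have leaf: "a = b" if "v \<rightarrow>\<^bsub>T\<^esub> a" "v \<rightarrow>\<^bsub>T\<^esub> b" "v \<noteq> c" for v a b
  proof -
    have "card (T.nbrs v) \<le> Suc 0" using uniq that T.adj_in_verts by blast
    then show ?thesis using that card_le_Suc0_iff_eq[OF T.finite_nbrs] by auto
  qed
  have to_c: "v \<rightarrow>\<^bsub>T\<^esub> c" if v: "v \<in> verts T" "v \<noteq> c" for v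
  proof (rule ccontr)
    assume not: "\<not> ?thesis"
    \<comment> \<open>If \<open>v\<close> missed \<open>c\<close>, each neighbour of
      \<open>v\<close> would differ from \<open>c\<close> and have \<open>v\<close> as its only
      neighbour, making \<open>?X\<close> a closed set without \<open>c\<close>.\<close>
    let ?X = "insert v (T.nbrs v)"
    have "w \<in> ?X" if "u \<in> ?X" "u \<rightarrow>\<^bsub>T\<^esub> w" for u w
    proof (cases "u = v")
      case False
      then have "u \<rightarrow>\<^bsub>T\<^esub> v" "u \<noteq> c" using that not T.dominates_sym by auto
      then have "w = v" using leaf that by blast
      then show ?thesis by simp
    qed (use that in simp)
    moreover have "connected T" using assms unfolding star_def utree_def by simp
    moreover have "?X \<subseteq> verts T" using v T.nbrs_subset by auto
    ultimately have "?X = verts T" unfolding T.connected_iff_cut by blast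
    then show False using c v not by auto
  qed
  have "u \<rightarrow>\<^bsub>T\<^esub> v \<longleftrightarrow> u \<in> verts T \<and> v \<in> verts T \<and> u \<noteq> v \<and> (u = c \<or> v = c)" for u v
  proof
    assume uv: "u \<rightarrow>\<^bsub>T\<^esub> v"
    then have "u \<in> verts T" "v \<in> verts T" "u \<noteq> v" using T.adj_in_verts T.adj_not_same by auto
    then show "u \<in> verts T \<and> v \<in> verts T \<and> u \<noteq> v \<and> (u = c \<or> v = c)"
      using leaf[OF uv to_c] by auto
  next
    assume "u \<in> verts T \<and> v \<in> verts T \<and> u \<noteq> v \<and> (u = c \<or> v = c)"
    then show "u \<rightarrow>\<^bsub>T\<^esub> v" using to_c T.dominates_sym[of c] by auto
  qed
  then show "\<exists>c\<in>verts T. \<forall>u v. u \<rightarrow>\<^bsub>T\<^esub> v \<longleftrightarrow>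
      u \<in> verts T \<and> v \<in> verts T \<and> u \<noteq> v \<and> (u = c \<or> v = c)"
    using c(1) by (intro bexI[of _ c]) simp_all
  show "3 \<le> card (verts T)"
  proof -
    have "card (insert c (T.nbrs c)) \<le> card (verts T)"
      using c T.nbrs_subset by (intro card_mono) auto
    then show ?thesis using c T.not_mem_nbrs_self by simp
  qed
qed

text \<open>Without parallel arcs the arc map is forced: each arc goes to the unique arc joining the
  images of its ends.\<close>

lemma digraph_isoI:
  assumes G: "nomulti_digraph G" and H: "nomulti_digraph H"
    and bij: "bij_betw \<phi> (verts G) (verts H)"
    and adj: "\<And>u v. u \<in> verts G \<Longrightarrow> v \<in> verts G \<Longrightarrow> u \<rightarrow>\<^bsub>G\<^esub> v \<longleftrightarrow> \<phi> u \<rightarrow>\<^bsub>H\<^esub> \<phi> v"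
  shows "digraph_iso G H"
proof -
  interpret G: nomulti_digraph G by (rule G)
  interpret H: nomulti_digraph H by (rule H)
  have "\<exists>e'\<in>arcs H. tail H e' = \<phi> (tail G e) \<and> head H e' = \<phi> (head G e)" if "e \<in> arcs G" for e
  proof -
    have "tail G e \<rightarrow>\<^bsub>G\<^esub> head G e" using that by (auto simp: arcs_ends_conv)
    then have "\<phi> (tail G e) \<rightarrow>\<^bsub>H\<^esub> \<phi> (head G e)" using that adj by simp
    then show ?thesis by (metis reachableE)
  qed
  then obtain g where g: "\<And>e. e \<in> arcs G \<Longrightarrow>
      g e \<in> arcs H \<and> tail H (g e) = \<phi> (tail G e) \<and> head H (g e) = \<phi> (head G e)"
    by metis
  have inj: "inj_on \<phi> (verts G)" and img: "\<phi> ` verts G = verts H"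
    using bij unfolding bij_betw_def by auto
  have inj_g: "inj_on g (arcs G)"
  proof (rule inj_onI)
    fix e e' assume e: "e \<in> arcs G" "e' \<in> arcs G" "g e = g e'"
    then have "\<phi> (tail G e) = \<phi> (tail G e')" "\<phi> (head G e) = \<phi> (head G e')" by (metis g)+
    then have "arc_to_ends G e = arc_to_ends G e'"
      unfolding arc_to_ends_def using inj_onD[OF inj] e by simp
    then show "e = e'" using G.no_multi_arcs e by blast
  qed
  have img_g: "g ` arcs G = arcs H"
  proof
    show "g ` arcs G \<subseteq> arcs H" using g by auto
    show "arcs H \<subseteq> g ` arcs G"
    proof
      fix e' assume e': "e' \<in> arcs H"
      then obtain u v where uv: "u \<in> verts G" "v \<in> verts G" "\<phi> u = tail H e'" "\<phi> v = head H e'"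
        using img by (metis H.head_in_verts H.tail_in_verts imageE)
      have "tail H e' \<rightarrow>\<^bsub>H\<^esub> head H e'" using e' by (auto simp: arcs_ends_conv)
      then have "u \<rightarrow>\<^bsub>G\<^esub> v" using adj uv by simp
      then obtain e where e: "e \<in> arcs G" "tail G e = u" "head G e = v" by (rule reachableE)
      then have "g e = e'"
        using g[OF e(1)] e' uv by (intro H.no_multi_arcs) (auto simp: arc_to_ends_def)
      then show "e' \<in> g ` arcs G" using e by auto
    qed
  qed
  \<comment> \<open>Taking the incidence functions of \<open>H\<close> itself makes
    \<open>app_iso ?f G\<close> equal to \<open>H\<close> as a record.\<close>
  let ?f = "\<lparr>iso_verts = \<phi>, iso_arcs = g, iso_head = head H, iso_tail = tail H\<rparr>"
  have "pre_digraph.digraph_isomorphism G ?f"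
    unfolding pre_digraph.digraph_isomorphism_def
    using G.wf_digraph inj inj_g g by simp
  moreover have "H = app_iso ?f G"
    by (rule pre_digraph.equality) (simp_all add: img img_g)
  ultimately show ?thesis unfolding digraph_iso_def by blast
qed

text \<open>Adjacency in both stars depends only on which vertex is the centre, so any bijection
  \<psi> of the leaves extends to an isomorphism by sending \<open>x\<close> to
  \<open>c\<close>.\<close>

lemma (in graph) digraph_iso_star_at:
  assumes T: "star T" "card (verts T) = Suc (card L)" and x: "x \<in> verts G" "L \<subseteq> nbrs x"
  shows "digraph_iso (star_at x L) T"
proof -
  interpret T: graph T using T unfolding star_def utree_def by simp
  have sub: "subgraph (star_at x L) G" by (rule subgraph_star_at[OF x])
  obtain c where c: "c \<in> verts T"
    and adj: "\<And>u v. u \<rightarrow>\<^bsub>T\<^esub> v \<longleftrightarrow> u \<in> verts T \<and> v \<in> verts T \<and> u \<noteq> v \<and> (u = c \<or> v = c)"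
    using star_center(1)[OF T(1)] by (elim bexE) simp
  have xL: "x \<notin> L" using x not_mem_nbrs_self by blast
  have "finite L" using x(2) finite_nbrs by (rule finite_subset)
  moreover have "card L = card (verts T - {c})" using T(2) c by simp
  ultimately obtain \<psi> where \<psi>: "bij_betw \<psi> L (verts T - {c})"
    using finite_same_card_bij[of L "verts T - {c}"] by auto
  define \<phi> where "\<phi> = \<psi>(x := c)"
  have \<phi>L: "\<phi> u \<in> verts T \<and> \<phi> u \<noteq> c" if "u \<in> L" for u
    using that \<psi> xL unfolding \<phi>_def bij_betw_def by auto
  have \<phi>x: "\<phi> x = c" unfolding \<phi>_def by simp
  have bij: "bij_betw \<phi> (insert x L) (verts T)"
  proof -
    have "bij_betw \<phi> L (verts T - {c})"
      using \<psi> xL bij_betw_cong[of L \<phi> \<psi>] unfolding \<phi>_def by fastforce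
    then have "bij_betw \<phi> (insert x L) (insert (\<phi> x) (verts T - {c}))"
      using xL \<phi>x by (intro notIn_Un_bij_betw[of x L \<phi>, simplified]) auto
    then show ?thesis using \<phi>x c by (simp add: insert_absorb)
  qed
  show ?thesis
  proof (rule digraph_isoI[of _ _ \<phi>])
    show "nomulti_digraph (star_at x L)"
      using digraph_subgraph[OF sub] by (rule digraph.axioms)
    show "nomulti_digraph T" by (rule T.nomulti_digraph)
    show "bij_betw \<phi> (verts (star_at x L)) (verts T)" using bij by simp
    fix u v assume "u \<in> verts (star_at x L)" "v \<in> verts (star_at x L)"
    then show "u \<rightarrow>\<^bsub>star_at x L\<^esub> v \<longleftrightarrow> \<phi> u \<rightarrow>\<^bsub>T\<^esub> \<phi> v"
      unfolding dominates_star_at[OF x(2)] adj using \<phi>x c xL by (auto dest: \<phi>L)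
  qed
qed

section \<open>Passage between nonseparable sets and 2-connected graphs\<close>

lemma (in graph) nonseparable_if_2_connected:
  assumes "k_connected 2 G"
  shows "nonseparable (verts G)"
  unfolding nonseparable_def
proof (intro conjI allI)
  show "2 \<le> card (verts G)" using assms unfolding k_connected_def by simp
  fix v
  \<comment> \<open>The intersection covers a \<open>v\<close> that is not a vertex:
    \<open>k_connected\<close> quantifies over subsets of \<open>verts G\<close> only.\<close>
  have "card ({v} \<inter> verts G) \<le> card {v}" by (intro card_mono) auto
  then have "connected (delete_verts G ({v} \<inter> verts G))"
    using assms unfolding k_connected_def by auto
  moreover have "verts G - {v} \<inter> verts G = verts G - {v}" by auto
  ultimately show "connected (G \<restriction> (verts G - {v}))" unfolding delete_verts_def by simp
qed simp

lemma (in graph) k_connected_2_induceI: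
  assumes "nonseparable S" "2 < card S" "x \<notin> S"
  shows "k_connected 2 (G \<restriction> S)"
  unfolding k_connected_def
proof (intro conjI allI impI)
  show "2 < card (verts (G \<restriction> S))" using assms by simp
  fix X assume X: "X \<subseteq> verts (G \<restriction> S) \<and> card X < 2"
  have "finite S" using assms(2) card.infinite by fastforce
  then have "finite X" using X finite_subset by auto
  \<comment> \<open>Nonseparability speaks of removing one element; for empty \<open>X\<close>, the
    element \<open>x\<close> outside \<open>S\<close> takes that role.\<close>
  obtain v where v: "S - X = S - {v}"
  proof (cases "X = {}")
    case True
    then show ?thesis using that[of x] assms(3) by simp
  next
    case False
    then have "card X = 1" using X \<open>finite X\<close> by (simp add: card_gt_0_iff less_2_cases_iff)
    then show ?thesis using that by (auto simp: card_1_singleton_iff)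
  qed
  then have "connected (G \<restriction> (S - X))" using assms unfolding nonseparable_def by simp
  moreover have "(G \<restriction> S) \<restriction> (S - X) = G \<restriction> (S - X)"
    by (auto simp: induce_subgraph_def)
  ultimately show "connected (delete_verts (G \<restriction> S) X)" unfolding delete_verts_def by simp
qed

theorem theorem2p1:
  fixes G :: "('a,'b) pre_digraph" and m :: nat
  assumes "m \<ge> 1"
    and "graph G"
    and "k_connected 2 G"
    and "min_degree G \<ge> m + 2"
  shows "\<forall>T :: ('c,'d) pre_digraph. star T \<and> card (verts T) = m \<longrightarrow>
    (\<exists>T'. subgraph T' G \<and> digraph_iso T' T \<and> k_connected 2 (delete_verts G (verts T')))"
proof (intro allI impI)
  fix T :: "('c,'d) pre_digraph" assume T: "star T \<and> card (verts T) = m"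
  interpret graph G by fact
  \<comment> \<open>The order of a star being at least 3, the truncated subtraction
    \<open>m - 1\<close> is exact and there is at least one leaf.\<close>
  have m: "3 \<le> m" using T star_center(2) by blast
  have deg: "(m - 1) + 3 \<le> card (nbrs v)" if "v \<in> verts G" for v
  proof -
    have "min_degree G \<le> out_degree G v" unfolding min_degree_def using that by (intro Min_le) auto
    then show ?thesis using assms(4) m unfolding card_nbrs by simp
  qed
  have "1 \<le> m - 1" using m by simp
  from star_with_nonseparable_complement[OF nonseparable_if_2_connected[OF assms(3)] this deg]
  obtain x L where x: "x \<in> verts G" "L \<subseteq> nbrs x" "card L = m - 1"
    and S: "nonseparable (verts G - insert x L)"
    by blast
  have "finite L" using x(2) finite_nbrs by (rule finite_subset)
  \<comment> \<open>A vertex with its neighbours accounts for at least \<open>m + 3\<close> vertices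
    and the star for at most \<open>m\<close>. The three or more that remain are what
    \<open>k_connected 2\<close> demands beyond nonseparability.\<close>
  have "card (insert x (nbrs x)) \<le> card (verts G)"
    using x nbrs_subset by (intro card_mono) auto
  then have "m + 3 \<le> card (verts G)" using deg[OF x(1)] m not_mem_nbrs_self by simp
  moreover have "card (insert x L) \<le> m"
    using x \<open>finite L\<close> m by (simp add: card_insert_if)
  moreover have "card (verts G) - card (insert x L) \<le> card (verts G - insert x L)"
    by (rule diff_card_le_card_Diff) (use \<open>finite L\<close> in simp)
  ultimately have "2 < card (verts G - insert x L)" by linarith
  then have "k_connected 2 (delete_verts G (verts (star_at x L)))"
    unfolding delete_verts_def using k_connected_2_induceI[OF S, of x] by simp
  moreover have "digraph_iso (star_at x L) T"
    using T x m by (intro digraph_iso_star_at) auto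
  ultimately show "\<exists>T'. subgraph T' G \<and> digraph_iso T' T \<and>
      k_connected 2 (delete_verts G (verts T'))"
    using subgraph_star_at[OF x(1,2)] by blast
qed

end
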